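(* Consider the control system $$\dot x=f(x,u)+w(x,t),\qquad u=-Kx,\qquad t\ge t_0, \qquad (P)$$ where $x\in\mathbb{R}^n$, $u\in\mathbb{R}^m$, $K$ is a constant $m\times n$ gain matrix, and $f,w$ satisfy the standing assumptions in the context. Assume that 1. $f(0,0)=0$; 2. the LTI pair $(A,B)$, where $A=f_x(0,0)$ and $B=f_u(0,0)$, is controllable; 3. for all $t\ge t_0$ (and all $x\in\mathbb{R}^n$), $|w(x,t)|\le c\,e^{\gamma(t-t_0)}$, where $c\ge 0$ and $\gamma<0$. Let $\lambda_m:=\max\{\Re(\lambda_i): i=1,\dots,n\}$, where $\lambda_1,\dots,\lambda_n$ are the eigenvalues of the matrix $A_{cl}=A-BK$, with $\lambda_i\ne\lambda_j$ for $i\ne j$, and let $\lambda_m<0$. Let $\eta:=\|T\|\,\|T^{-1}\|$, where $T$ is a similarity transformation for which $\Lambda=T^{-1}A_{cl}T=\mathrm{diag}(\lambda_i)$. Let $\Gamma_0>0$ and $\varepsilon_0>0$ be such that $|R_1(x,-Kx)|\le\Gamma_0|x|$ for $|x|\le\varepsilon_0$, where $R_1(x,u)$ is the Taylor expansion remainder of the function $f(x,u)$ expanded at the point $(x,u)=(0,0)$, i.e. $f(x,u)=Ax+Bu+R_1(x,u)$. Further assume that for the desired eigenvalues $\lambda_i$, $i=1,\dots,n$, of the matrix $A_{cl}=A-BK$ there exists such a $\Gamma_0>0$ with $$\lambda_m<-\eta\,\Gamma_0\,(1+\|K\|).$$ Then: a) the origin $x=0$ is eventually locally asymptotically stable for (P),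 in the sense of the definition in the context; b) for all $x(t_0)$ satisfying $|x(t_0)|\le\delta$ one has $|x(t)|\le\varepsilon_0$ for all $t\ge t_0$, and moreover $|x(t)|\to0^+$ (exponentially) as $t\to\infty$, where $\delta$ is a positive solution of the equation $$\eta\left(\delta+\frac{c}{\lambda_m-\gamma}\right)=\varepsilon_0,$$ which always exists for sufficiently small values of $c\ge0$ and $\gamma$, $\gamma<\lambda_m<0$; c) the radius of the lower bound of the region of attraction satisfies $\delta=\delta(\varepsilon_0,\lambda_m,c,\gamma)\le\varepsilon_0/\eta$, with equality only if $c=0$, that is, for $w(x,t)\equiv0$.
   Context: Standing assumptions: $f$ is an $n$-dimensional vector function of $(x,u)\in\mathbb{R}^n\times\mathbb{R}^m$, continuous in $(x,u)$ and twice continuously differentiable with respect to the components of $x$ and $u$ for $|x|<\infty$, $|u|<\infty$; $f(0,0)=0$; $w$ is an $n$-dimensional vector function, continuous in $(x,t)$ for $|x|<\infty$, $t_0\le t<\infty$; and the domain of existence of trajectories for the control systems under consideration is the interval $[t_0,\infty)$ for every initial state $x(t_0)\in\mathbb{R}^n$. Notation: $|\cdot|$ is the Euclidean norm and $\|\cdot\|$ the matrix norm induced by it, $\|M\|=\max_{|x|=1}|Mx|$. The $n\times n$ matrix $f_x(0,0)$ and the $n\times m$ matrix $f_u(0,0)$ are the Jacobian matrices of $f(x,u)$ with respect to $x$ and $u$, evaluated at $(0,0)$. $\Re(z)$ is the real part of the complex number $z$. The pair $(A,B)$ is controllable if the matrix $(B\ AB\ \cdots\ A^{n-1}B)$ has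 rank $n$. Definition (eventual local asymptotic stability). The origin $x=0$ is eventually locally asymptotically stable for the perturbed closed-loop system $\dot x=f(x,u)+w(x,t)$, $u=-Kx$, $t\ge t_0$, if for every $\tilde\varepsilon>0$ there exist $t^*(\tilde\varepsilon)\ge0$ and $\tilde\delta(\tilde\varepsilon)>0$ such that if $|x(t_0)|<\tilde\delta$ then $|x(t)|<\tilde\varepsilon$ for all $t\ge t_0+t^*$, and, moreover, $|x(t)|\to0^+$ as $t\to\infty$. A stronger form of eventual local asymptotic stability is that $|x(t)|\le\alpha_1|x(t_0)|e^{\alpha_2(t-t_0)}$ for all $t\ge t_0+t^*$, where $\alpha_1>0$, $\alpha_2<0$ and $|x(t_0)|<\tilde\delta$, that is, the solution converges to the origin exponentially as $t\to\infty$. (The point $x=0$ need not be a solution of the perturbed system.)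
   Formalization: Part a) is false for large c (w can push x to another attractor), so it is stated for all γ<0 with c below a threshold independent of w and γ, and for all c and γ<λ_m for which the equation for δ has a positive solution. *)

theory Defs
  imports "HOL-Analysis.Analysis"
begin

(* Euclidean operator norm: norm on real ^ 'n and complex ^ 'n is the Euclidean one, and
   onorm is the supremum of norm (M *v x) / norm x, that is, the maximum over unit vectors. *)
definition mat_norm :: "('a::real_normed_field)^'n^'m \<Rightarrow> real" where
  "mat_norm M = onorm (\<lambda>x. M *v x)"

definition eigenvalue :: "complex^'n^'n \<Rightarrow> complex \<Rightarrow> bool" where
  "eigenvalue M z \<longleftrightarrow> (\<exists>v. v \<noteq> 0 \<and> M *v v = z *s v)"

definition diag_mat :: "('n \<Rightarrow> 'a::zero) \<Rightarrow> 'a^'n^'n" where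
  "diag_mat d = (\<chi> i j. if i = j then d i else 0)"

(* The block matrix (B, AB, ..., A^(n-1) B) with n = CARD('n). Its columns are indexed by
   pairs (k, j); to_nat_on UNIV is a bijection from 'n onto {..<CARD('n)}, so the blocks are
   exactly A^0 B, ..., A^(n-1) B. *)
definition controllability_matrix :: "real^'n^'n \<Rightarrow> real^'m^'n \<Rightarrow> real^('n \<times> 'm)^'n" where
  "controllability_matrix A B =
     (\<chi> i p. ((((**) A) ^^ to_nat_on (UNIV :: 'n set) (fst p)) B) $ i $ snd p)"

definition controllable :: "real^'n^'n \<Rightarrow> real^'m^'n \<Rightarrow> bool" where
  "controllable A B \<longleftrightarrow> rank (controllability_matrix A B) = CARD('n)"

definition twice_cont_differentiable ::
    "('a::real_normed_vector \<Rightarrow> 'b::real_normed_vector) \<Rightarrow> bool" where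
  "twice_cont_differentiable g \<longleftrightarrow>
     (\<exists>D D2. (\<forall>p. (g has_derivative blinfun_apply (D p)) (at p)) \<and>
             (\<forall>p. (D has_derivative blinfun_apply (D2 p)) (at p)) \<and>
             continuous_on UNIV D2)"

(* f_x(0,0) and f_u(0,0) *)
definition jac_x :: "(real^'n \<Rightarrow> real^'m \<Rightarrow> real^'n) \<Rightarrow> real^'n^'n" where
  "jac_x f = jacobian (\<lambda>x. f x 0) (at 0)"

definition jac_u :: "(real^'n \<Rightarrow> real^'m \<Rightarrow> real^'n) \<Rightarrow> real^'m^'n" where
  "jac_u f = jacobian (\<lambda>u. f 0 u) (at 0)"

definition taylor_remainder ::
    "(real^'n \<Rightarrow> real^'m \<Rightarrow> real^'n) \<Rightarrow> real^'n \<Rightarrow> real^'m \<Rightarrow> real^'n" where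
  "taylor_remainder f x u = f x u - (jac_x f *v x + jac_u f *v u)"

(* Solutions on [t0, \<infinity>) of x' = f(x,u) + w(x,t), u = -Kx; the derivative at t0 is one-sided. *)
definition trajectory ::
    "(real^'n \<Rightarrow> real^'m \<Rightarrow> real^'n) \<Rightarrow> real^'n^'m \<Rightarrow> (real^'n \<Rightarrow> real \<Rightarrow> real^'n) \<Rightarrow> real
      \<Rightarrow> (real \<Rightarrow> real^'n) \<Rightarrow> bool" where
  "trajectory f K w t0 x \<longleftrightarrow>
     (\<forall>t\<ge>t0. (x has_vector_derivative (f (x t) (- (K *v x t)) + w (x t) t)) (at t within {t0..}))"

(* Besides the bound on w this contains the standing assumptions that involve w: continuity
   and existence of trajectories on all of [t0, \<infinity>) from every initial state. *)
definition admissible_perturbation ::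
    "(real^'n \<Rightarrow> real^'m \<Rightarrow> real^'n) \<Rightarrow> real^'n^'m \<Rightarrow> real \<Rightarrow> (real^'n \<Rightarrow> real \<Rightarrow> real^'n)
      \<Rightarrow> real \<Rightarrow> real \<Rightarrow> bool" where
  "admissible_perturbation f K t0 w c \<gamma> \<longleftrightarrow>
     continuous_on (UNIV \<times> {t0..}) (\<lambda>(x, t). w x t) \<and>
     (\<forall>x0. \<exists>x. trajectory f K w t0 x \<and> x t0 = x0) \<and>
     0 \<le> c \<and> \<gamma> < 0 \<and>
     (\<forall>t\<ge>t0. \<forall>x. norm (w x t) \<le> c * exp (\<gamma> * (t - t0)))"

definition eventually_locally_asymptotically_stable ::
    "(real^'n \<Rightarrow> real^'m \<Rightarrow> real^'n) \<Rightarrow> real^'n^'m \<Rightarrow> (real^'n \<Rightarrow> real \<Rightarrow> real^'n) \<Rightarrow> real \<Rightarrow> bool"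
  where
  "eventually_locally_asymptotically_stable f K w t0 \<longleftrightarrow>
     (\<forall>\<epsilon>>0. \<exists>ts\<ge>0. \<exists>\<delta>>0. \<forall>x. trajectory f K w t0 x \<and> norm (x t0) < \<delta> \<longrightarrow>
        (\<forall>t\<ge>t0 + ts. norm (x t) < \<epsilon>) \<and> ((\<lambda>t. norm (x t)) \<longlongrightarrow> 0) at_top)"

end

theory Submission
  imports Defs
begin

text \<open>
  In the eigenbasis coordinates \<open>y = T\<inverse> x\<close> the linear part of the closed loop is diagonal, so the
  real inner product of \<open>y\<close> with its velocity is at most \<open>\<mu> |y|\<^sup>2\<close> plus the contribution of the
  Taylor remainder and of the perturbation. As long as the remainder at the current state is at
  most \<open>\<Gamma> |x|\<close>, passing from \<open>y\<close> to \<open>x\<close> and back costs the factor \<open>\<eta>\<close>, and \<open>|y|\<close> satisfies the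
  scalar inequality \<open>|y|' \<le> \<sigma> |y| + b exp (\<gamma> (t - t0))\<close> with \<open>\<sigma> = \<mu> + \<eta> \<Gamma>\<close>. Solving the corresponding
  linear equation gives, for \<open>\<sigma> \<noteq> \<gamma>\<close>,
  \<open>|x t| \<le> \<eta> (|x t0| + c / |\<sigma> - \<gamma>|) exp (max \<sigma> \<gamma> (t - t0))\<close>
  (\<open>norm_le_of_inner_derivative_le\<close> and \<open>perturbed_diagonalisable_bound\<close>). The diagonal argument
  replaces the variation of constants formula and Gronwall's lemma.

  The remainder estimate is known only in the ball of radius \<open>\<epsilon>0\<close>, so one has to see that the
  trajectory stays there. The initial radius is chosen so that the right-hand side above is at most
  \<open>\<epsilon>0\<close>, but the trajectory may start on the boundary of the ball (if \<open>\<eta> = 1\<close> and \<open>c = 0\<close>), and then nothing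
  is known about the remainder just outside. Therefore the argument is run with a constant \<open>\<Gamma>\<close>
  slightly larger than \<open>\<Gamma>0\<close>, which the strict spectral gap permits: wherever \<open>|x| \<le> \<epsilon>0\<close> and \<open>x \<noteq> 0\<close>
  the estimate with \<open>\<Gamma>\<close> is strict, hence persists for a short time by continuity, and real
  induction extends it to all times (\<open>perturbed_nonlinear_bound\<close>).

  Everything else is bookkeeping with this bound. If \<open>\<gamma> < \<mu>\<close>, then \<open>\<sigma> - \<gamma> > \<mu> - \<gamma>\<close>, so the equation
  defining \<open>\<delta>\<close> makes the factor in front of the exponential at most \<open>\<epsilon>0\<close>, and the decay rate is \<open>\<sigma>\<close>. For
  arbitrary \<open>\<gamma> < 0\<close> the perturbation also decays at the slower rate \<open>max (\<sigma> / 2) \<gamma>\<close>, whose distance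
  from \<open>\<sigma>\<close> is at least \<open>|\<sigma>| / 2\<close> independently of \<open>\<gamma>\<close>; hence one bound on \<open>c\<close> serves all \<open>\<gamma>\<close>.
\<close>

section \<open>Induction along the real line\<close>

text \<open>
  The infimum of the times at which the property fails is excluded by the limit step if it fails
  there, and by the other step if it fails only immediately afterwards.
\<close>
lemma real_induction_from:
  fixes a :: real
  assumes base: "P a"
    and limit: "\<And>t. a < t \<Longrightarrow> (\<And>s. a \<le> s \<Longrightarrow> s < t \<Longrightarrow> P s) \<Longrightarrow> P t"
    and step: "\<And>t. a \<le> t \<Longrightarrow> (\<And>s. a \<le> s \<Longrightarrow> s \<le> t \<Longrightarrow> P s) \<Longrightarrow> eventually P (at_right t)"
    and "a \<le> t"
  shows "P t"
proof (rule ccontr)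
  assume "\<not> P t"
  define S where "S = {s. a \<le> s \<and> \<not> P s}"
  have ne: "S \<noteq> {}" and bdd: "bdd_below S"
    using \<open>\<not> P t\<close> \<open>a \<le> t\<close> by (auto simp: S_def intro: bdd_belowI)
  have le: "a \<le> Inf S"
    using ne by (intro cInf_greatest) (auto simp: S_def)
  have before: "P s" if "a \<le> s" "s < Inf S" for s
    using that cInf_lower[OF _ bdd, of s] by (force simp: S_def)
  have at: "P (Inf S)"
    using base limit[of "Inf S"] before le by (cases "Inf S = a") auto
  have "eventually P (at_right (Inf S))"
    using step[of "Inf S"] before at le by (metis less_eq_real_def)
  then obtain b where b: "Inf S < b" "\<And>s. Inf S < s \<Longrightarrow> s < b \<Longrightarrow> P s"
    by (auto simp: eventually_at_right_field)
  obtain s where s: "s \<in> S" "s < b"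
    using b(1) ne bdd by (meson cInf_less_iff)
  then have "Inf S \<le> s" using bdd by (intro cInf_lower)
  then show False using s b(2)[of s] at by (auto simp: S_def less_eq_real_def)
qed

section \<open>Scalar comparison\<close>

text \<open>
  The hypothesis says \<open>|y| |y|' \<le> \<sigma> |y|\<^sup>2 + b exp (\<gamma> (t - t0)) |y|\<close>; after division by \<open>|y|\<close>, comparison
  with the solution of the linear equation gives the bound. As the norm is not differentiable at
  zeros of \<open>y\<close>, the comparison is done for the smooth majorant \<open>v = sqrt (|y|\<^sup>2 + e\<^sup>2)\<close>.
  Since \<open>\<sigma> < 0\<close>, the difference \<open>v - e\<close> satisfies the same inequality without an error term, and
  \<open>e\<close> tends to 0 at the end.
\<close>

lemma norm_le_of_inner_derivative_le:
  fixes y :: "real \<Rightarrow> 'a::real_inner"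
  assumes deriv: "\<And>t. t0 \<le> t \<Longrightarrow> t \<le> t1 \<Longrightarrow> (y has_vector_derivative y' t) (at t within {t0..})"
    and bound: "\<And>t. t0 \<le> t \<Longrightarrow> t \<le> t1 \<Longrightarrow>
        y t \<bullet> y' t \<le> \<sigma> * (norm (y t))\<^sup>2 + b * exp (\<gamma> * (t - t0)) * norm (y t)"
    and "\<sigma> < 0" "0 \<le> b" "\<sigma> \<noteq> \<gamma>" "t0 \<le> t1"
  shows "norm (y t1) \<le> (norm (y t0) + b / \<bar>\<sigma> - \<gamma>\<bar>) * exp (max \<sigma> \<gamma> * (t1 - t0))"
proof -
  \<comment> \<open>The solution of \<open>\<phi>' = \<sigma> \<phi> + b exp (\<gamma> (t - t0))\<close> with the initial value of \<open>|y|\<close>.\<close>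
  define k where "k = b / (\<sigma> - \<gamma>)"
  have b_eq: "b = k * (\<sigma> - \<gamma>)" using \<open>\<sigma> \<noteq> \<gamma>\<close> by (simp add: k_def)
  define \<phi> where "\<phi> t = norm (y t0) * exp (\<sigma> * (t - t0))
     + k * (exp (\<sigma> * (t - t0)) - exp (\<gamma> * (t - t0)))" for t
  have \<phi>_deriv: "(\<phi> has_real_derivative \<sigma> * \<phi> t + b * exp (\<gamma> * (t - t0))) (at t)" for t
    unfolding \<phi>_def b_eq by (auto intro!: derivative_eq_intros simp: algebra_simps)
  have y_cont: "continuous_on {t0..t1} y"
    by (auto simp: continuous_on_eq_continuous_within
        intro: continuous_within_subset[OF has_vector_derivative_continuous[OF deriv]])
  have approx: "norm (y t1) \<le> \<phi> t1 + e" if "e > 0" for e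
  proof -
    define v where "v t = sqrt (y t \<bullet> y t + e\<^sup>2)" for t
    define h where "h t = exp (- \<sigma> * (t - t0)) * (v t - e - \<phi> t)" for t
    have pos: "y t \<bullet> y t + e\<^sup>2 > 0" for t
      using \<open>e > 0\<close> by (simp add: add_nonneg_pos)
    have v_pos: "v t > 0" for t using pos by (simp add: v_def)
    have v_sq: "(v t)\<^sup>2 = (norm (y t))\<^sup>2 + e\<^sup>2" for t
      using pos[of t] by (simp add: v_def power2_norm_eq_inner)
    have v_ge: "e \<le> v t" "norm (y t) \<le> v t" for t
      by (rule power2_le_imp_le; use v_sq[of t] v_pos[of t] in simp)+
    \<comment> \<open>With the integrating factor, the comparison of \<open>v - e\<close> with \<open>\<phi>\<close> becomes monotonicity of \<open>h\<close>.\<close>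
    have "h t1 \<le> h t0"
    proof (rule DERIV_nonpos_imp_decreasing_open[OF \<open>t0 \<le> t1\<close>])
      show "continuous_on {t0..t1} h"
        unfolding h_def v_def \<phi>_def by (intro continuous_intros y_cont)
    next
      fix t assume t: "t0 < t" "t < t1"
      then have "at t within {t0..} = at t"
        by (intro at_within_open_subset[of _ "{t0<..}"]) auto
      then have "(y has_vector_derivative y' t) (at t)"
        using deriv[of t] t by simp
      then have "((\<lambda>t. y t \<bullet> y t) has_real_derivative 2 * (y t \<bullet> y' t)) (at t)"
        unfolding has_vector_derivative_def has_field_derivative_def
        by (auto intro!: derivative_eq_intros simp: inner_commute algebra_simps)
      then have v_deriv: "(v has_real_derivative (y t \<bullet> y' t) / v t) (at t)"
        unfolding v_def using pos[of t]
        by (auto intro!: derivative_eq_intros simp: field_simps)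
      have "y t \<bullet> y' t \<le> \<sigma> * (v t)\<^sup>2 - \<sigma> * e * e + b * exp (\<gamma> * (t - t0)) * norm (y t)"
        unfolding v_sq using bound[of t] t by (simp add: algebra_simps power2_eq_square)
      also have "\<dots> \<le> \<sigma> * (v t)\<^sup>2 - \<sigma> * e * v t + b * exp (\<gamma> * (t - t0)) * v t"
      proof -
        have "(- \<sigma> * e) * e \<le> (- \<sigma> * e) * v t"
          using v_ge(1)[of t] \<open>\<sigma> < 0\<close> \<open>e > 0\<close>
          by (intro mult_left_mono) (auto simp: mult_le_0_iff)
        moreover have "b * exp (\<gamma> * (t - t0)) * norm (y t) \<le> b * exp (\<gamma> * (t - t0)) * v t"
          using v_ge(2)[of t] \<open>0 \<le> b\<close> by (intro mult_left_mono) auto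
        ultimately show ?thesis by simp
      qed
      finally have v'_le: "(y t \<bullet> y' t) / v t \<le> \<sigma> * (v t - e) + b * exp (\<gamma> * (t - t0))"
        using v_pos[of t]
        by (subst pos_divide_le_eq) (simp_all add: algebra_simps power2_eq_square)
      have "(h has_real_derivative exp (- \<sigma> * (t - t0)) *
         ((y t \<bullet> y' t) / v t - (\<sigma> * (v t - e) + b * exp (\<gamma> * (t - t0))))) (at t)"
        unfolding h_def
        by (auto intro!: derivative_eq_intros v_deriv \<phi>_deriv simp: algebra_simps)
      moreover have "exp (- \<sigma> * (t - t0)) *
         ((y t \<bullet> y' t) / v t - (\<sigma> * (v t - e) + b * exp (\<gamma> * (t - t0)))) \<le> 0"
        using v'_le by (intro mult_nonneg_nonpos) auto
      ultimately show "\<exists>D. (h has_real_derivative D) (at t) \<and> D \<le> 0" by blast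
    qed
    also have "h t0 \<le> 0"
    proof -
      have "v t0 \<le> norm (y t0) + e"
        by (rule power2_le_imp_le) (use \<open>e > 0\<close> in \<open>auto simp: v_sq power2_sum\<close>)
      then show ?thesis by (simp add: h_def \<phi>_def)
    qed
    finally have "v t1 \<le> \<phi> t1 + e"
      by (simp add: h_def mult_le_0_iff)
    then show ?thesis using v_ge(2)[of t1] by linarith
  qed
  have "norm (y t1) \<le> \<phi> t1"
    by (rule field_le_epsilon) (use approx in auto)
  also have "\<dots> \<le> norm (y t0) * exp (max \<sigma> \<gamma> * (t1 - t0))
      + b / \<bar>\<sigma> - \<gamma>\<bar> * exp (max \<sigma> \<gamma> * (t1 - t0))"
    unfolding \<phi>_def
  proof (rule add_mono)
    show "norm (y t0) * exp (\<sigma> * (t1 - t0)) \<le> norm (y t0) * exp (max \<sigma> \<gamma> * (t1 - t0))"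
      using \<open>t0 \<le> t1\<close> by (intro mult_left_mono) (auto intro: mult_right_mono)
    have "(exp (\<sigma> * (t1 - t0)) - exp (\<gamma> * (t1 - t0))) / (\<sigma> - \<gamma>)
        \<le> exp (max \<sigma> \<gamma> * (t1 - t0)) / \<bar>\<sigma> - \<gamma>\<bar>"
      using \<open>\<sigma> \<noteq> \<gamma>\<close> by (cases "\<gamma> < \<sigma>") (auto simp: max_def field_simps)
    from mult_left_mono[OF this \<open>0 \<le> b\<close>]
    show "k * (exp (\<sigma> * (t1 - t0)) - exp (\<gamma> * (t1 - t0)))
        \<le> b / \<bar>\<sigma> - \<gamma>\<bar> * exp (max \<sigma> \<gamma> * (t1 - t0))"
      by (simp add: k_def)
  qed
  finally show ?thesis by (simp add: distrib_right)
qed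

section \<open>Complex coordinates and operator norms\<close>

text \<open>
  The state is real, but the matrix \<open>T\<close> that diagonalises the closed loop is complex; this isometric
  embedding lets \<open>T\<close> act on the state.
\<close>

definition complexify :: "real^'n \<Rightarrow> complex^'n" where
  "complexify x = (\<chi> i. of_real (x $ i))"

lemma norm_complexify [simp]: "norm (complexify x) = norm x"
  by (simp add: complexify_def norm_vec_def)

lemma bounded_linear_complexify: "bounded_linear complexify"
  by (intro bounded_linear_intro[where K = 1]) (auto simp: complexify_def vec_eq_iff
     scaleR_conv_of_real[where 'a = complex] norm_complexify[unfolded complexify_def])

lemma complexify_matrix_vector_mult:
  "complexify (M *v x) = map_matrix of_real M *v complexify x"
  by (simp add: complexify_def vec_eq_iff matrix_vector_mult_def)

lemma matrix_inv_right:
  assumes "invertible M"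
  shows "M ** matrix_inv M = mat 1"
  using someI_ex[OF assms[unfolded invertible_def]] by (simp add: matrix_inv_def)

lemma norm_matrix_vector_le:
  fixes M :: "('a::{real_normed_field,euclidean_space})^'n^'m"
  shows "norm (M *v x) \<le> mat_norm M * norm x"
  unfolding mat_norm_def by (rule onorm) simp

lemma mat_norm_nonneg:
  fixes M :: "('a::{real_normed_field,euclidean_space})^'n^'m"
  shows "0 \<le> mat_norm M"
  unfolding mat_norm_def by (rule onorm_pos_le) simp

lemma condition_number_ge_1:
  fixes M :: "('a::{real_normed_field,euclidean_space})^'n^'n"
  assumes "invertible M"
  shows "1 \<le> mat_norm M * mat_norm (matrix_inv M)"
proof -
  obtain v :: "'a^'n" where "norm v = 1"
    using vector_choose_size[of 1] by auto
  have "norm v = norm (M *v (matrix_inv M *v v))"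
    using assms by (simp add: matrix_vector_mul_assoc matrix_inv_right)
  also have "\<dots> \<le> mat_norm M * (mat_norm (matrix_inv M) * norm v)"
    by (meson norm_matrix_vector_le mat_norm_nonneg mult_left_mono order_trans)
  finally show ?thesis using \<open>norm v = 1\<close> by simp
qed

lemma diag_mat_mult_vec: "(diag_mat d *v y) $ i = d i * y $ i"
  by (simp add: diag_mat_def matrix_vector_mult_def if_distrib[of "\<lambda>a. a * _"] cong: if_cong)

text \<open>
  The real inner product of a complex number \<open>z\<close> with \<open>d z\<close> is \<open>Re d |z|\<^sup>2\<close>: the imaginary part of an
  eigenvalue only rotates and does not change the norm.
\<close>

lemma inner_diag_mat_le:
  fixes y :: "complex^'n"
  assumes "\<And>i. Re (d i) \<le> \<mu>"
  shows "y \<bullet> (diag_mat d *v y) \<le> \<mu> * (norm y)\<^sup>2"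
proof -
  have "y $ i \<bullet> (d i * y $ i) = Re (d i) * (y $ i \<bullet> y $ i)" for i
    by (simp add: inner_complex_def algebra_simps)
  then have "y \<bullet> (diag_mat d *v y) = (\<Sum>i\<in>UNIV. Re (d i) * (y $ i \<bullet> y $ i))"
    by (simp add: inner_vec_def diag_mat_mult_vec)
  also have "\<dots> \<le> (\<Sum>i\<in>UNIV. \<mu> * (y $ i \<bullet> y $ i))"
    using assms by (intro sum_mono mult_right_mono) auto
  also have "\<dots> = \<mu> * (norm y)\<^sup>2"
    by (simp add: power2_norm_eq_inner inner_vec_def sum_distrib_left)
  finally show ?thesis .
qed

section \<open>Perturbed diagonalisable systems\<close>

text \<open>
  In the coordinates \<open>y = T\<inverse> x\<close> the forcing term has norm at most
  \<open>\<parallel>T\<inverse>\<parallel> (\<Gamma> \<parallel>T\<parallel> |y| + c exp (\<gamma> (t - t0)))\<close>. Its part proportional to \<open>|y|\<close> shifts the rate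
  from \<open>\<mu>\<close> to \<open>\<sigma>\<close>, and the rest is the inhomogeneity of the scalar comparison.
\<close>

lemma perturbed_diagonalisable_bound:
  fixes M :: "real^'n^'n" and T :: "complex^'n^'n" and x g :: "real \<Rightarrow> real^'n"
  assumes T_inv: "invertible T"
    and T_diag: "matrix_inv T ** map_matrix of_real M ** T = diag_mat ev"
    and ev_le: "\<And>i. Re (ev i) \<le> \<mu>"
    and deriv: "\<And>t. t0 \<le> t \<Longrightarrow> t \<le> t1 \<Longrightarrow>
        (x has_vector_derivative M *v x t + g t) (at t within {t0..})"
    and g_le: "\<And>t. t0 \<le> t \<Longrightarrow> t \<le> t1 \<Longrightarrow> norm (g t) \<le> \<Gamma> * norm (x t) + c * exp (\<gamma> * (t - t0))"
    and \<eta>_eq: "\<eta> = mat_norm T * mat_norm (matrix_inv T)"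
    and \<sigma>_eq: "\<sigma> = \<mu> + \<eta> * \<Gamma>"
    and "0 \<le> \<Gamma>" "0 \<le> c" "\<sigma> < 0" "\<sigma> \<noteq> \<gamma>" "t0 \<le> t1"
  shows "norm (x t1) \<le> \<eta> * (norm (x t0) + c / \<bar>\<sigma> - \<gamma>\<bar>) * exp (max \<sigma> \<gamma> * (t1 - t0))"
proof -
  define S where "S = matrix_inv T"
  define y where "y t = S *v complexify (x t)" for t
  have x_eq: "complexify (x t) = T *v y t" for t
    using T_inv by (simp add: y_def S_def matrix_vector_mul_assoc matrix_inv_right)
  have x_le: "norm (x t) \<le> mat_norm T * norm (y t)" for t
    by (metis norm_complexify x_eq norm_matrix_vector_le)
  have lin: "bounded_linear (\<lambda>x. S *v complexify x)"
    using bounded_linear_compose[OF matrix_vector_mul_bounded_linear bounded_linear_complexify] .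
  have y_deriv: "(y has_vector_derivative diag_mat ev *v y t + S *v complexify (g t)) (at t within {t0..})"
    if "t0 \<le> t" "t \<le> t1" for t
  proof -
    have "S *v complexify (M *v x t) = diag_mat ev *v y t"
      unfolding complexify_matrix_vector_mult x_eq T_diag[symmetric] S_def
      by (simp add: matrix_vector_mul_assoc matrix_mul_assoc)
    then have "S *v complexify (M *v x t + g t) = diag_mat ev *v y t + S *v complexify (g t)"
      using linear_add[OF bounded_linear.linear[OF lin]] by simp
    then show ?thesis
      using bounded_linear.has_vector_derivative[OF lin deriv[OF that]]
      by (simp add: y_def[abs_def])
  qed
  have y_bound: "y t \<bullet> (diag_mat ev *v y t + S *v complexify (g t))
      \<le> \<sigma> * (norm (y t))\<^sup>2 + (mat_norm S * c) * exp (\<gamma> * (t - t0)) * norm (y t)"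
    if "t0 \<le> t" "t \<le> t1" for t
  proof -
    have "norm (g t) \<le> \<Gamma> * (mat_norm T * norm (y t)) + c * exp (\<gamma> * (t - t0))"
      using g_le[OF that] mult_left_mono[OF x_le[of t] \<open>0 \<le> \<Gamma>\<close>] by linarith
    then have "mat_norm S * norm (g t)
        \<le> mat_norm S * (\<Gamma> * (mat_norm T * norm (y t)) + c * exp (\<gamma> * (t - t0)))"
      by (intro mult_left_mono mat_norm_nonneg)
    moreover have "norm (S *v complexify (g t)) \<le> mat_norm S * norm (g t)"
      using norm_matrix_vector_le[of S "complexify (g t)"] by simp
    ultimately have "norm (S *v complexify (g t))
        \<le> \<eta> * \<Gamma> * norm (y t) + mat_norm S * c * exp (\<gamma> * (t - t0))"
      by (simp add: \<eta>_eq S_def algebra_simps)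
    then have "norm (y t) * norm (S *v complexify (g t))
        \<le> norm (y t) * (\<eta> * \<Gamma> * norm (y t) + mat_norm S * c * exp (\<gamma> * (t - t0)))"
      by (intro mult_left_mono) auto
    moreover have "y t \<bullet> (S *v complexify (g t)) \<le> norm (y t) * norm (S *v complexify (g t))"
      by (rule norm_cauchy_schwarz)
    moreover have "y t \<bullet> (diag_mat ev *v y t) \<le> \<mu> * (norm (y t))\<^sup>2"
      by (rule inner_diag_mat_le) (rule ev_le)
    ultimately show ?thesis
      by (simp add: inner_add_right \<sigma>_eq algebra_simps power2_eq_square)
  qed
  have "norm (y t1)
      \<le> (norm (y t0) + mat_norm S * c / \<bar>\<sigma> - \<gamma>\<bar>) * exp (max \<sigma> \<gamma> * (t1 - t0))"
    by (rule norm_le_of_inner_derivative_le[OF y_deriv y_bound])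
      (use \<open>0 \<le> c\<close> \<open>\<sigma> < 0\<close> \<open>\<sigma> \<noteq> \<gamma>\<close> \<open>t0 \<le> t1\<close> in \<open>auto intro: mult_nonneg_nonneg mat_norm_nonneg\<close>)
  also have "\<dots> \<le> (mat_norm S * norm (x t0) + mat_norm S * c / \<bar>\<sigma> - \<gamma>\<bar>) * exp (max \<sigma> \<gamma> * (t1 - t0))"
    using norm_matrix_vector_le[of S "complexify (x t0)"]
    by (intro mult_right_mono add_right_mono) (auto simp: y_def)
  finally have "mat_norm T * norm (y t1) \<le> mat_norm T * \<dots>"
    by (intro mult_left_mono mat_norm_nonneg)
  with x_le[of t1] have "norm (x t1) \<le> mat_norm T *
      ((mat_norm S * norm (x t0) + mat_norm S * c / \<bar>\<sigma> - \<gamma>\<bar>) * exp (max \<sigma> \<gamma> * (t1 - t0)))"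
    by linarith
  also have "\<dots> = \<eta> * (norm (x t0) + c / \<bar>\<sigma> - \<gamma>\<bar>) * exp (max \<sigma> \<gamma> * (t1 - t0))"
    by (simp add: \<eta>_eq S_def algebra_simps)
  finally show ?thesis .
qed

text \<open>
  The linear estimate applies up to time \<open>s\<close> if \<open>|R (x r)| \<le> \<Gamma> |x r|\<close> for all earlier \<open>r\<close>. It then gives
  \<open>|x s| \<le> \<epsilon>\<close>, so the better constant \<open>\<Gamma>0\<close> is available at \<open>s\<close>, and this leaves room for the condition
  with \<open>\<Gamma>\<close> to survive beyond \<open>s\<close> even if \<open>x s\<close> lies on the boundary of the ball.
\<close>

lemma perturbed_nonlinear_bound:
  fixes M :: "real^'n^'n" and T :: "complex^'n^'n" and x g :: "real \<Rightarrow> real^'n"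
    and R :: "real^'n \<Rightarrow> real^'n"
  assumes T_inv: "invertible T"
    and T_diag: "matrix_inv T ** map_matrix of_real M ** T = diag_mat ev"
    and ev_le: "\<And>i. Re (ev i) \<le> \<mu>"
    and deriv: "\<And>t. t0 \<le> t \<Longrightarrow>
        (x has_vector_derivative M *v x t + (R (x t) + g t)) (at t within {t0..})"
    and R_cont: "continuous_on UNIV R"
    and R_le: "\<And>x. norm x \<le> \<epsilon> \<Longrightarrow> norm (R x) \<le> \<Gamma>0 * norm x"
    and g_le: "\<And>t. t0 \<le> t \<Longrightarrow> norm (g t) \<le> c * exp (\<gamma> * (t - t0))"
    and \<eta>_eq: "\<eta> = mat_norm T * mat_norm (matrix_inv T)"
    and \<sigma>_eq: "\<sigma> = \<mu> + \<eta> * \<Gamma>"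
    and "0 < \<epsilon>" "0 \<le> \<Gamma>0" "\<Gamma>0 < \<Gamma>" "0 \<le> c" "\<gamma> < 0" "\<sigma> < 0" "\<sigma> \<noteq> \<gamma>" "t0 \<le> t"
    and init: "\<eta> * (norm (x t0) + c / \<bar>\<sigma> - \<gamma>\<bar>) \<le> \<epsilon>"
  shows "norm (x t) \<le> \<epsilon> * exp (max \<sigma> \<gamma> * (t - t0))"
proof -
  define P where "P s \<longleftrightarrow> norm (R (x s)) \<le> \<Gamma> * norm (x s)" for s
  have x_cont: "continuous_on {t0..} x"
    by (auto simp: continuous_on_eq_continuous_within
        intro: has_vector_derivative_continuous[OF deriv])
  have Rx_cont: "continuous_on {t0..} (\<lambda>s. R (x s))"
    using continuous_on_compose2[OF R_cont x_cont] by simp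
  have small_P: "P s" if "norm (x s) \<le> \<epsilon>" for s
    using R_le[OF that] mult_right_mono[of \<Gamma>0 \<Gamma> "norm (x s)"] \<open>\<Gamma>0 < \<Gamma>\<close> by (simp add: P_def)
  have bound: "norm (x s) \<le> \<epsilon> * exp (max \<sigma> \<gamma> * (s - t0))"
    if "t0 \<le> s" and P: "\<And>r. t0 \<le> r \<Longrightarrow> r \<le> s \<Longrightarrow> P r" for s
  proof -
    have "norm (R (x r) + g r) \<le> \<Gamma> * norm (x r) + c * exp (\<gamma> * (r - t0))"
      if "t0 \<le> r" "r \<le> s" for r
      using P[OF that] g_le[OF that(1)] norm_triangle_ineq[of "R (x r)" "g r"]
      by (simp add: P_def)
    then have "norm (x s) \<le> \<eta> * (norm (x t0) + c / \<bar>\<sigma> - \<gamma>\<bar>) * exp (max \<sigma> \<gamma> * (s - t0))"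
      using perturbed_diagonalisable_bound[OF T_inv T_diag ev_le deriv _ \<eta>_eq \<sigma>_eq] assms that
      by auto
    also have "\<dots> \<le> \<epsilon> * exp (max \<sigma> \<gamma> * (s - t0))"
      using init by (intro mult_right_mono) auto
    finally show ?thesis .
  qed
  have P: "P s" if "t0 \<le> s" for s
    using _ _ _ that
  proof (rule real_induction_from)
    have "norm (x t0) \<le> \<eta> * norm (x t0)"
      using condition_number_ge_1[OF T_inv] mult_right_mono[of 1 \<eta> "norm (x t0)"] by (simp add: \<eta>_eq)
    also have "\<dots> \<le> \<eta> * (norm (x t0) + c / \<bar>\<sigma> - \<gamma>\<bar>)"
      using condition_number_ge_1[OF T_inv] \<open>0 \<le> c\<close> by (intro mult_left_mono) (auto simp: \<eta>_eq)
    finally show "P t0" using init small_P by force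
  next
    fix s assume s: "t0 < s" and before: "\<And>r. t0 \<le> r \<Longrightarrow> r < s \<Longrightarrow> P r"
    have at_left: "at s within {t0..<s} \<noteq> bot"
      using s by (simp add: trivial_limit_within islimpt_Ico)
    have lim_x: "(x \<longlongrightarrow> x s) (at s within {t0..<s})"
      and lim_R: "((\<lambda>r. R (x r)) \<longlongrightarrow> R (x s)) (at s within {t0..<s})"
      using x_cont Rx_cont s
      by (auto simp: continuous_on_def intro!: tendsto_within_subset[where T = "{t0..<s}" and S = "{t0..}"])
    have ev_P: "\<forall>\<^sub>F r in at s within {t0..<s}. norm (R (x r)) \<le> \<Gamma> * norm (x r)"
      using before by (auto simp: eventually_at_filter P_def)
    show "P s"
      unfolding P_def
      by (rule tendsto_le[OF at_left _ _ ev_P]) (intro tendsto_intros lim_x lim_R)+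
  next
    fix s assume s: "t0 \<le> s" and before: "\<And>r. t0 \<le> r \<Longrightarrow> r \<le> s \<Longrightarrow> P r"
    have lim_x: "(x \<longlongrightarrow> x s) (at_right s)"
      and lim_R: "((\<lambda>r. R (x r)) \<longlongrightarrow> R (x s)) (at_right s)"
      using x_cont Rx_cont s
      by (auto simp: continuous_on_def intro!: tendsto_within_subset[where T = "{s<..}" and S = "{t0..}"])
    \<comment> \<open>At \<open>x s = 0\<close> the estimate is an equality, but nearby states are in the interior of the ball.\<close>
    show "eventually P (at_right s)"
    proof (cases "x s = 0")
      case True
      then have "\<forall>\<^sub>F r in at_right s. norm (x r) < \<epsilon>"
        using \<open>0 < \<epsilon>\<close> by (intro order_tendstoD(2)[OF tendsto_norm[OF lim_x]]) auto
      then show ?thesis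
        by eventually_elim (simp add: small_P)
    next
      case False
      have "max \<sigma> \<gamma> * (s - t0) \<le> 0"
        using \<open>\<sigma> < 0\<close> \<open>\<gamma> < 0\<close> s by (intro mult_nonpos_nonneg) auto
      then have "\<epsilon> * exp (max \<sigma> \<gamma> * (s - t0)) \<le> \<epsilon>"
        using \<open>0 < \<epsilon>\<close> by (simp add: mult_le_cancel_left1)
      then have "norm (x s) \<le> \<epsilon>"
        using bound[OF s before] by linarith
      then have "norm (R (x s)) \<le> \<Gamma>0 * norm (x s)" by (rule R_le)
      also have "\<dots> < \<Gamma> * norm (x s)"
        using \<open>\<Gamma>0 < \<Gamma>\<close> False by (intro mult_strict_right_mono) auto
      finally have "norm (R (x s)) < \<Gamma> * norm (x s)" .
      then have "0 < \<Gamma> * norm (x s) - norm (R (x s))" by simp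
      then have "\<forall>\<^sub>F r in at_right s. 0 < \<Gamma> * norm (x r) - norm (R (x r))"
        by (intro order_tendstoD(1)[of _ "\<Gamma> * norm (x s) - norm (R (x s))"] tendsto_intros lim_x lim_R)
      then show ?thesis
        by eventually_elim (simp add: P_def)
    qed
  qed
  show ?thesis using bound P \<open>t0 \<le> t\<close> by blast
qed

section \<open>Consequences of uniform exponential bounds\<close>

lemma tendsto_mult_exp_neg_at_top:
  fixes \<kappa> C :: real
  assumes "\<kappa> < 0"
  shows "((\<lambda>s. C * exp (\<kappa> * s)) \<longlongrightarrow> 0) at_top"
proof -
  have "filterlim (\<lambda>s. \<kappa> * s) at_bot at_top"
    by (rule filterlim_tendsto_neg_mult_at_bot[OF tendsto_const assms filterlim_ident])
  from filterlim_compose[OF exp_at_bot this] show ?thesis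
    by (rule tendsto_mult_right_zero)
qed

lemma exponential_bound_tendsto_0:
  fixes x :: "real \<Rightarrow> 'a::real_normed_vector"
  assumes "\<kappa> < 0" and bound: "\<And>t. t0 \<le> t \<Longrightarrow> norm (x t) \<le> C * exp (\<kappa> * (t - t0))"
  shows "((\<lambda>t. norm (x t)) \<longlongrightarrow> 0) at_top"
proof (rule tendsto_sandwich[OF _ _ tendsto_const])
  show "\<forall>\<^sub>F t in at_top. norm (x t) \<le> C * exp (\<kappa> * (t - t0))"
    using eventually_ge_at_top[of t0] by eventually_elim (rule bound)
  have "filterlim (\<lambda>t. t - t0) at_top at_top"
    using filterlim_tendsto_add_at_top[OF tendsto_const filterlim_ident, of "- t0"] by simp
  from filterlim_compose[OF tendsto_mult_exp_neg_at_top[OF \<open>\<kappa> < 0\<close>] this]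
  show "((\<lambda>t. C * exp (\<kappa> * (t - t0))) \<longlongrightarrow> 0) at_top" .
qed simp

text \<open>
  A waiting time that brings the bound \<open>C exp (\<kappa> s)\<close> below the tolerance works for all trajectories
  from the ball at once; the radius \<open>d\<close> need not shrink with the tolerance.
\<close>

lemma uniform_exponential_bound_imp_stable:
  assumes "0 < d" "\<kappa> < 0"
    and bound: "\<And>x t. trajectory f K w t0 x \<Longrightarrow> norm (x t0) \<le> d \<Longrightarrow> t0 \<le> t \<Longrightarrow>
        norm (x t) \<le> C * exp (\<kappa> * (t - t0))"
  shows "eventually_locally_asymptotically_stable f K w t0"
  unfolding eventually_locally_asymptotically_stable_def
proof (intro allI impI)
  fix e :: real assume "0 < e"
  have "\<forall>\<^sub>F s in at_top. C * exp (\<kappa> * s) < e"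
    by (rule order_tendstoD(2)[OF tendsto_mult_exp_neg_at_top[OF \<open>\<kappa> < 0\<close>] \<open>0 < e\<close>])
  then obtain N where N: "\<And>s. N \<le> s \<Longrightarrow> C * exp (\<kappa> * s) < e"
    by (auto simp: eventually_at_top_linorder)
  show "\<exists>ts\<ge>0. \<exists>\<delta>>0. \<forall>x. trajectory f K w t0 x \<and> norm (x t0) < \<delta> \<longrightarrow>
      (\<forall>t\<ge>t0 + ts. norm (x t) < e) \<and> ((\<lambda>t. norm (x t)) \<longlongrightarrow> 0) at_top"
  proof (rule exI[of _ "max N 0"], rule conjI, simp, rule exI[of _ d], rule conjI,
      rule \<open>0 < d\<close>, intro allI impI)
    fix x assume x: "trajectory f K w t0 x \<and> norm (x t0) < d"
    then have le: "norm (x t) \<le> C * exp (\<kappa> * (t - t0))" if "t0 \<le> t" for t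
      using bound that by simp
    have "norm (x t) < e" if "t0 + max N 0 \<le> t" for t
      using le[of t] N[of "t - t0"] that by force
    then show "(\<forall>t\<ge>t0 + max N 0. norm (x t) < e) \<and> ((\<lambda>t. norm (x t)) \<longlongrightarrow> 0) at_top"
      using exponential_bound_tendsto_0[OF \<open>\<kappa> < 0\<close> le] by blast
  qed
qed

section \<open>Stability and the region of attraction\<close>

text \<open>
  The equation is linear in \<open>\<delta>\<close>, with solution \<open>\<epsilon> / \<eta> - c / (\<mu> - \<gamma>)\<close>. Keeping \<open>\<gamma>\<close> away from \<open>\<mu>\<close>
  makes the subtracted term small with \<open>c\<close>; the chosen bound on \<open>c\<close> keeps it at most \<open>\<epsilon> / (2 \<eta>)\<close>.
\<close>

lemma unique_radius_if_perturbation_small: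
  fixes \<mu> \<eta> \<epsilon> :: real
  assumes "0 < \<eta>" "0 < \<epsilon>" "b < \<mu>"
  shows "\<exists>cbar>0. \<forall>c \<gamma>. 0 \<le> c \<and> c \<le> cbar \<and> \<gamma> \<le> b \<longrightarrow>
        (\<exists>!\<delta>. \<delta> > 0 \<and> \<eta> * (\<delta> + c / (\<mu> - \<gamma>)) = \<epsilon>)"
proof (rule exI[of _ "\<epsilon> * (\<mu> - b) / (2 * \<eta>)"], intro conjI allI impI)
  show "0 < \<epsilon> * (\<mu> - b) / (2 * \<eta>)" using assms by simp
  fix c \<gamma> assume c: "0 \<le> c \<and> c \<le> \<epsilon> * (\<mu> - b) / (2 * \<eta>) \<and> \<gamma> \<le> b"
  have "c / (\<mu> - \<gamma>) \<le> (\<epsilon> * (\<mu> - b) / (2 * \<eta>)) / (\<mu> - b)"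
    using c assms by (intro frac_le) auto
  also have "\<dots> < \<epsilon> / \<eta>" using assms by (simp add: field_simps)
  finally have "0 < \<epsilon> / \<eta> - c / (\<mu> - \<gamma>)" by simp
  moreover have "\<eta> * (\<delta> + c / (\<mu> - \<gamma>)) = \<epsilon> \<longleftrightarrow> \<delta> = \<epsilon> / \<eta> - c / (\<mu> - \<gamma>)" for \<delta>
    using assms by (auto simp: eq_diff_eq eq_divide_eq mult.commute)
  ultimately show "\<exists>!\<delta>. \<delta> > 0 \<and> \<eta> * (\<delta> + c / (\<mu> - \<gamma>)) = \<epsilon>"
    by metis
qed

theorem theorem3:
  fixes f :: "real^'n \<Rightarrow> real^'m \<Rightarrow> real^'n"
    and K :: "real^'n^'m"
    and A Acl :: "real^'n^'n"
    and B :: "real^'m^'n"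
    and T :: "complex^'n^'n"
    and ev :: "'n \<Rightarrow> complex"
    and t0 \<mu> \<eta> \<Gamma>0 \<epsilon>0 :: real
  assumes f_cont: "continuous_on UNIV (\<lambda>(x, u). f x u)"
    and f_C2: "twice_cont_differentiable (\<lambda>(x, u). f x u)"
    and f_zero: "f 0 0 = 0"
    and A_eq: "A = jac_x f"
    and B_eq: "B = jac_u f"
    and contr: "controllable A B"
    and Acl_eq: "Acl = A - B ** K"
    and eigs: "range ev = {z. eigenvalue (map_matrix complex_of_real Acl) z}"
    and eigs_distinct: "\<And>i j. i \<noteq> j \<Longrightarrow> ev i \<noteq> ev j"
    and \<mu>_eq: "\<mu> = Max (range (\<lambda>i. Re (ev i)))"
    and \<mu>_neg: "\<mu> < 0"
    and T_inv: "invertible T"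
    and T_diag: "matrix_inv T ** map_matrix complex_of_real Acl ** T = diag_mat ev"
    and \<eta>_eq: "\<eta> = mat_norm T * mat_norm (matrix_inv T)"
    and \<Gamma>0_pos: "\<Gamma>0 > 0"
    and \<epsilon>0_pos: "\<epsilon>0 > 0"
    and remainder: "\<And>x. norm x \<le> \<epsilon>0 \<Longrightarrow> norm (taylor_remainder f x (- (K *v x))) \<le> \<Gamma>0 * norm x"
    and gap: "\<mu> < - \<eta> * \<Gamma>0 * (1 + mat_norm K)"
  shows
    (* The second conjunct also contains the stability claim, with the solvability of the equation
       for \<delta> as the only smallness condition. The bound proportional to norm (x t0) is stated for
       nonzero x t0 with a trajectory-dependent factor, since the origin need not be a solution. *)
    "(\<exists>cbar>0. \<forall>w c \<gamma>. admissible_perturbation f K t0 w c \<gamma> \<and> c \<le> cbar \<longrightarrow>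
        eventually_locally_asymptotically_stable f K w t0)
   \<and> (\<forall>w c \<gamma> \<delta>. admissible_perturbation f K t0 w c \<gamma> \<and> \<gamma> < \<mu> \<and>
        \<delta> > 0 \<and> \<eta> * (\<delta> + c / (\<mu> - \<gamma>)) = \<epsilon>0 \<longrightarrow>
          eventually_locally_asymptotically_stable f K w t0 \<and>
          (\<forall>x. trajectory f K w t0 x \<and> norm (x t0) \<le> \<delta> \<longrightarrow>
             (\<forall>t\<ge>t0. norm (x t) \<le> \<epsilon>0) \<and> ((\<lambda>t. norm (x t)) \<longlongrightarrow> 0) at_top) \<and>
          (\<exists>\<alpha>1>0. \<exists>\<alpha>2<0. \<forall>x. trajectory f K w t0 x \<and> norm (x t0) \<le> \<delta> \<longrightarrow>
             (\<forall>t\<ge>t0. norm (x t) \<le> \<alpha>1 * exp (\<alpha>2 * (t - t0)))) \<and>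
          (\<exists>\<alpha>2<0. \<forall>x. trajectory f K w t0 x \<and> 0 < norm (x t0) \<and> norm (x t0) \<le> \<delta> \<longrightarrow>
             (\<exists>\<alpha>1>0. \<forall>t\<ge>t0. norm (x t) \<le> \<alpha>1 * norm (x t0) * exp (\<alpha>2 * (t - t0)))) \<and>
          \<delta> \<le> \<epsilon>0 / \<eta> \<and>
          (\<delta> = \<epsilon>0 / \<eta> \<longrightarrow> c = 0 \<and> (\<forall>t\<ge>t0. \<forall>x. w x t = 0)))
   \<and> (\<forall>\<gamma>bar<\<mu>. \<exists>cbar>0. \<forall>c \<gamma>. 0 \<le> c \<and> c \<le> cbar \<and> \<gamma> \<le> \<gamma>bar \<longrightarrow>
        (\<exists>!\<delta>. \<delta> > 0 \<and> \<eta> * (\<delta> + c / (\<mu> - \<gamma>)) = \<epsilon>0))"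
proof -
  have \<eta>_ge: "1 \<le> \<eta>"
    unfolding \<eta>_eq by (rule condition_number_ge_1[OF T_inv])
  \<comment> \<open>Halfway between \<open>\<Gamma>0\<close> and the critical value \<open>- \<mu> / \<eta>\<close> at which the rate \<open>\<sigma>\<close> would vanish.\<close>
  define \<Gamma> where "\<Gamma> = (\<Gamma>0 - \<mu> / \<eta>) / 2"
  define \<sigma> where "\<sigma> = \<mu> + \<eta> * \<Gamma>"
  have "\<eta> * \<Gamma>0 * 1 \<le> \<eta> * \<Gamma>0 * (1 + mat_norm K)"
    using \<eta>_ge \<Gamma>0_pos mat_norm_nonneg[of K] by (intro mult_left_mono) auto
  then have \<mu>_lt: "\<mu> < - (\<eta> * \<Gamma>0)"
    using gap by (simp add: mult.assoc)
  then have "\<Gamma>0 < - \<mu> / \<eta>"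
    by (subst pos_less_divide_eq) (use \<eta>_ge in \<open>auto simp: mult.commute\<close>)
  then have \<Gamma>_gt: "\<Gamma>0 < \<Gamma>" by (simp add: \<Gamma>_def)
  have \<sigma>_alt: "\<sigma> = (\<mu> + \<eta> * \<Gamma>0) / 2"
    using \<eta>_ge by (simp add: \<sigma>_def \<Gamma>_def field_simps)
  have \<sigma>_neg: "\<sigma> < 0" using \<mu>_lt by (simp add: \<sigma>_alt)
  have \<mu>_less_\<sigma>: "\<mu> < \<sigma>"
    using \<Gamma>_gt \<Gamma>0_pos \<eta>_ge by (simp add: \<sigma>_def)
  have ev_le: "Re (ev i) \<le> \<mu>" for i
    unfolding \<mu>_eq by (intro Max_ge) auto
  define R where "R z = taylor_remainder f z (- (K *v z))" for z
  have R_cont: "continuous_on UNIV R"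
  proof -
    have K_cont: "continuous_on UNIV (\<lambda>z. K *v z)"
      and A_cont: "continuous_on UNIV (\<lambda>z. jac_x f *v z)"
      by (rule linear_continuous_on[OF matrix_vector_mul_bounded_linear])+
    have B_cont: "continuous_on UNIV (\<lambda>z. jac_u f *v - (K *v z))"
      by (intro bounded_linear.continuous_on[OF matrix_vector_mul_bounded_linear]
          continuous_on_minus K_cont)
    have "continuous_on UNIV (\<lambda>z. case (z, - (K *v z)) of (x, u) \<Rightarrow> f x u)"
      by (rule continuous_on_compose2[OF f_cont])
        (auto intro!: continuous_on_Pair continuous_on_id continuous_on_minus K_cont)
    then show ?thesis
      unfolding R_def taylor_remainder_def
      by (intro continuous_on_diff continuous_on_add A_cont B_cont) simp
  qed
  \<comment> \<open>The rate \<open>\<kappa>\<close> may be slower than the rate \<open>\<gamma>\<close> of the perturbation, which keeps \<open>\<bar>\<sigma> - \<kappa>\<bar>\<close>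
      away from 0 when needed.\<close>
  have decay: "norm (x t) \<le> \<epsilon>0 * exp (max \<sigma> \<kappa> * (t - t0))"
    if adm: "admissible_perturbation f K t0 w c \<gamma>" and x: "trajectory f K w t0 x"
      and x0: "norm (x t0) \<le> d" and \<kappa>: "\<gamma> \<le> \<kappa>" "\<kappa> < 0" "\<kappa> \<noteq> \<sigma>"
      and d: "\<eta> * (d + c / \<bar>\<sigma> - \<kappa>\<bar>) \<le> \<epsilon>0" and t: "t0 \<le> t"
    for w c \<gamma> \<kappa> d x t
  proof (rule perturbed_nonlinear_bound[OF T_inv T_diag ev_le _ R_cont _ _ \<eta>_eq \<sigma>_def \<epsilon>0_pos _ \<Gamma>_gt])
    show "0 \<le> c" using adm by (simp add: admissible_perturbation_def)
    show "(x has_vector_derivative Acl *v x s + (R (x s) + w (x s) s)) (at s within {t0..})"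
      if "t0 \<le> s" for s
    proof -
      have eq: "f (x s) (- (K *v x s)) + w (x s) s = Acl *v x s + (R (x s) + w (x s) s)"
        using linear_neg[OF matrix_vector_mul_linear[of B], of "K *v x s"]
        by (simp add: R_def taylor_remainder_def Acl_eq A_eq B_eq matrix_vector_mult_diff_rdistrib
            matrix_vector_mul_assoc)
      show ?thesis
        using x that unfolding trajectory_def eq[symmetric] by blast
    qed
    show "norm (R z) \<le> \<Gamma>0 * norm z" if "norm z \<le> \<epsilon>0" for z
      using remainder[OF that] by (simp add: R_def)
    show "norm (w (x s) s) \<le> c * exp (\<kappa> * (s - t0))" if "t0 \<le> s" for s
    proof -
      have "norm (w (x s) s) \<le> c * exp (\<gamma> * (s - t0))"
        using adm that by (simp add: admissible_perturbation_def)
      also have "\<dots> \<le> c * exp (\<kappa> * (s - t0))"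
        using \<open>0 \<le> c\<close> \<kappa>(1) that by (intro mult_left_mono) (auto intro: mult_right_mono)
      finally show ?thesis .
    qed
    have "\<eta> * (norm (x t0) + c / \<bar>\<sigma> - \<kappa>\<bar>) \<le> \<eta> * (d + c / \<bar>\<sigma> - \<kappa>\<bar>)"
      using x0 \<eta>_ge by (intro mult_left_mono) auto
    then show "\<eta> * (norm (x t0) + c / \<bar>\<sigma> - \<kappa>\<bar>) \<le> \<epsilon>0" using d by linarith
  qed (use \<Gamma>0_pos \<kappa> \<sigma>_neg t in auto)
  have "\<exists>cbar>0. \<forall>w c \<gamma>. admissible_perturbation f K t0 w c \<gamma> \<and> c \<le> cbar \<longrightarrow>
        eventually_locally_asymptotically_stable f K w t0"
  \<comment> \<open>The budget \<open>\<epsilon>0\<close> is split evenly: half for the initial state, half for the perturbation, whose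
      share is at most \<open>2 \<eta> c / \<bar>\<sigma>\<bar>\<close>.\<close>
  proof (rule exI[of _ "- \<sigma> * \<epsilon>0 / (4 * \<eta>)"], intro conjI allI impI)
    show "0 < - \<sigma> * \<epsilon>0 / (4 * \<eta>)"
      using \<sigma>_neg \<epsilon>0_pos \<eta>_ge by (intro divide_pos_pos mult_pos_pos) auto
    fix w c \<gamma> assume asm: "admissible_perturbation f K t0 w c \<gamma> \<and> c \<le> - \<sigma> * \<epsilon>0 / (4 * \<eta>)"
    define \<kappa> where "\<kappa> = max (\<sigma> / 2) \<gamma>"
    have \<kappa>: "\<gamma> \<le> \<kappa>" "\<kappa> < 0" "\<sigma> < \<kappa>" "- \<sigma> / 2 \<le> \<bar>\<sigma> - \<kappa>\<bar>"
      using asm \<sigma>_neg by (auto simp: \<kappa>_def admissible_perturbation_def)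
    have c0: "0 \<le> c" using asm by (simp add: admissible_perturbation_def)
    have "c / \<bar>\<sigma> - \<kappa>\<bar> \<le> (- \<sigma> * \<epsilon>0 / (4 * \<eta>)) / (- \<sigma> / 2)"
      using asm c0 \<kappa> \<sigma>_neg \<epsilon>0_pos \<eta>_ge by (intro frac_le) auto
    also have "\<dots> = \<epsilon>0 / (2 * \<eta>)" using \<sigma>_neg \<eta>_ge by (simp add: field_simps)
    finally have "\<eta> * (\<epsilon>0 / (2 * \<eta>) + c / \<bar>\<sigma> - \<kappa>\<bar>) \<le> \<eta> * (\<epsilon>0 / (2 * \<eta>) + \<epsilon>0 / (2 * \<eta>))"
      using \<eta>_ge by (intro mult_left_mono) auto
    also have "\<dots> = \<epsilon>0" using \<eta>_ge by simp
    finally have budget: "\<eta> * (\<epsilon>0 / (2 * \<eta>) + c / \<bar>\<sigma> - \<kappa>\<bar>) \<le> \<epsilon>0" .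
    show "eventually_locally_asymptotically_stable f K w t0"
    proof (rule uniform_exponential_bound_imp_stable)
      show "0 < \<epsilon>0 / (2 * \<eta>)" using \<epsilon>0_pos \<eta>_ge by simp
      show "max \<sigma> \<kappa> < 0" using \<sigma>_neg \<kappa> by simp
      show "norm (x t) \<le> \<epsilon>0 * exp (max \<sigma> \<kappa> * (t - t0))"
        if "trajectory f K w t0 x" "norm (x t0) \<le> \<epsilon>0 / (2 * \<eta>)" "t0 \<le> t" for x t
        using decay[OF _ that(1,2) _ _ _ budget that(3)] asm \<kappa> by blast
    qed
  qed
  moreover have "eventually_locally_asymptotically_stable f K w t0 \<and>
          (\<forall>x. trajectory f K w t0 x \<and> norm (x t0) \<le> \<delta> \<longrightarrow>
             (\<forall>t\<ge>t0. norm (x t) \<le> \<epsilon>0) \<and> ((\<lambda>t. norm (x t)) \<longlongrightarrow> 0) at_top) \<and>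
          (\<exists>\<alpha>1>0. \<exists>\<alpha>2<0. \<forall>x. trajectory f K w t0 x \<and> norm (x t0) \<le> \<delta> \<longrightarrow>
             (\<forall>t\<ge>t0. norm (x t) \<le> \<alpha>1 * exp (\<alpha>2 * (t - t0)))) \<and>
          (\<exists>\<alpha>2<0. \<forall>x. trajectory f K w t0 x \<and> 0 < norm (x t0) \<and> norm (x t0) \<le> \<delta> \<longrightarrow>
             (\<exists>\<alpha>1>0. \<forall>t\<ge>t0. norm (x t) \<le> \<alpha>1 * norm (x t0) * exp (\<alpha>2 * (t - t0)))) \<and>
          \<delta> \<le> \<epsilon>0 / \<eta> \<and>
          (\<delta> = \<epsilon>0 / \<eta> \<longrightarrow> c = 0 \<and> (\<forall>t\<ge>t0. \<forall>x. w x t = 0))"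
    if adm: "admissible_perturbation f K t0 w c \<gamma>" and "\<gamma> < \<mu>" "\<delta> > 0"
      and \<delta>_eq: "\<eta> * (\<delta> + c / (\<mu> - \<gamma>)) = \<epsilon>0" for w c \<gamma> \<delta>
  proof -
    have c0: "0 \<le> c" and w_le: "\<And>t x. t0 \<le> t \<Longrightarrow> norm (w x t) \<le> c * exp (\<gamma> * (t - t0))"
      using adm by (auto simp: admissible_perturbation_def)
    have "c / \<bar>\<sigma> - \<gamma>\<bar> \<le> c / (\<mu> - \<gamma>)"
      using \<mu>_less_\<sigma> \<open>\<gamma> < \<mu>\<close> c0 by (intro divide_left_mono) auto
    then have "\<eta> * (\<delta> + c / \<bar>\<sigma> - \<gamma>\<bar>) \<le> \<eta> * (\<delta> + c / (\<mu> - \<gamma>))"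
      using \<eta>_ge by (intro mult_left_mono) auto
    then have budget: "\<eta> * (\<delta> + c / \<bar>\<sigma> - \<gamma>\<bar>) \<le> \<epsilon>0" using \<delta>_eq by simp
    have bound: "norm (x t) \<le> \<epsilon>0 * exp (\<sigma> * (t - t0))"
      if "trajectory f K w t0 x" "norm (x t0) \<le> \<delta>" "t0 \<le> t" for x t
      using decay[OF adm that(1,2) _ _ _ budget that(3)] \<open>\<gamma> < \<mu>\<close> \<mu>_less_\<sigma> \<sigma>_neg
      by (simp add: max_def)
    have stays: "norm (x t) \<le> \<epsilon>0"
      if "trajectory f K w t0 x" "norm (x t0) \<le> \<delta>" "t0 \<le> t" for x t
    proof -
      have "\<sigma> * (t - t0) \<le> 0" using \<sigma>_neg that by (intro mult_nonpos_nonneg) auto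
      then have "\<epsilon>0 * exp (\<sigma> * (t - t0)) \<le> \<epsilon>0"
        using \<epsilon>0_pos by (simp add: mult_le_cancel_left1)
      then show ?thesis using bound[OF that] by linarith
    qed
    have \<delta>_alt: "\<delta> = \<epsilon>0 / \<eta> - c / (\<mu> - \<gamma>)"
      using \<delta>_eq \<eta>_ge by (simp add: eq_diff_eq eq_divide_eq mult.commute)
    have ratio: "0 \<le> c / (\<mu> - \<gamma>)" "c / (\<mu> - \<gamma>) = 0 \<longleftrightarrow> c = 0"
      using c0 \<open>\<gamma> < \<mu>\<close> by auto
    have "eventually_locally_asymptotically_stable f K w t0"
      using uniform_exponential_bound_imp_stable[where C = \<epsilon>0, OF \<open>\<delta> > 0\<close> \<sigma>_neg] bound by blast
    moreover have "\<forall>x. trajectory f K w t0 x \<and> norm (x t0) \<le> \<delta> \<longrightarrow>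
             (\<forall>t\<ge>t0. norm (x t) \<le> \<epsilon>0) \<and> ((\<lambda>t. norm (x t)) \<longlongrightarrow> 0) at_top"
      using stays bound exponential_bound_tendsto_0[where C = \<epsilon>0, OF \<sigma>_neg] by blast
    moreover have "\<exists>\<alpha>1>0. \<exists>\<alpha>2<0. \<forall>x. trajectory f K w t0 x \<and> norm (x t0) \<le> \<delta> \<longrightarrow>
             (\<forall>t\<ge>t0. norm (x t) \<le> \<alpha>1 * exp (\<alpha>2 * (t - t0)))"
      using bound \<epsilon>0_pos \<sigma>_neg by blast
    moreover have "\<exists>\<alpha>2<0. \<forall>x. trajectory f K w t0 x \<and> 0 < norm (x t0) \<and> norm (x t0) \<le> \<delta> \<longrightarrow>
             (\<exists>\<alpha>1>0. \<forall>t\<ge>t0. norm (x t) \<le> \<alpha>1 * norm (x t0) * exp (\<alpha>2 * (t - t0)))"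
    proof (rule exI[of _ \<sigma>], rule conjI, rule \<sigma>_neg, intro allI impI)
      fix x assume x: "trajectory f K w t0 x \<and> 0 < norm (x t0) \<and> norm (x t0) \<le> \<delta>"
      then have "0 < \<epsilon>0 / norm (x t0)" "\<epsilon>0 / norm (x t0) * norm (x t0) = \<epsilon>0"
        using \<epsilon>0_pos by auto
      then show "\<exists>\<alpha>1>0. \<forall>t\<ge>t0. norm (x t) \<le> \<alpha>1 * norm (x t0) * exp (\<sigma> * (t - t0))"
        using bound x by metis
    qed
    moreover have "\<delta> \<le> \<epsilon>0 / \<eta>" using \<delta>_alt ratio by linarith
    moreover have "c = 0 \<and> (\<forall>t\<ge>t0. \<forall>x. w x t = 0)" if "\<delta> = \<epsilon>0 / \<eta>"
    proof -
      have "c = 0" using that \<delta>_alt ratio by linarith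
      then show ?thesis using w_le by simp
    qed
    ultimately show ?thesis by blast
  qed
  moreover have "\<exists>cbar>0. \<forall>c \<gamma>. 0 \<le> c \<and> c \<le> cbar \<and> \<gamma> \<le> \<gamma>bar \<longrightarrow>
        (\<exists>!\<delta>. \<delta> > 0 \<and> \<eta> * (\<delta> + c / (\<mu> - \<gamma>)) = \<epsilon>0)" if "\<gamma>bar < \<mu>" for \<gamma>bar
    using unique_radius_if_perturbation_small[OF _ \<epsilon>0_pos that] \<eta>_ge by simp
  ultimately show ?thesis by blast
qed

end
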